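(* Let $(p_i)_{i \in \mathbb{N}}$ be a sequence of distinct primes, $(c_i)_{i \in \mathbb{N}}$ a sequence of integers, and $(H_i)_{i \in \mathbb{N}}$ a sequence of thick subsets of $\mathbb{N}$. The set $$A = \bigcup_{i=1}^\infty \big( (p_i \mathbb{N} + c_i) \cap H_i \big)$$ is dynamically thick. Moreover, if for all $n \in \mathbb{N}$ we have that $c_n \not\equiv 0 \bmod p_n$ and that, for all but finitely many pairs $(i,j)$ of distinct positive integers, the set $H_i \cap (H_j - n)$ is empty, then the set $A$ is not an IP set.
   Context: $\mathbb{N}$ is the set of positive integers. All set operations produce subsets of $\mathbb{N}$: $p\mathbb{N} + c = \{pn + c : n \in \mathbb{N}\} \cap \mathbb{N}$ and $H - n = \{m \in \mathbb{N} : m + n \in H\}$. A set $H \subseteq \mathbb{N}$ is thick if for every finite $F \subseteq \mathbb{N}$ there is $n \in \mathbb{N}$ with $F + n \subseteq H$. A (topological dynamical) system $(X,T)$ is a nonempty compact metric space $X$ together with a continuous map $T : X \to X$. It is minimal if the only nonempty closed $Y \subseteq X$ with $TY \subseteq Y$ is $Y = X$. A set $A \subseteq \mathbb{N}$ is dynamically thick if for all minimal systems $(X,T)$, all $x \in X$, and all nonempty open $U \subseteq X$, there exists $n \in A$ with $T^n x \in U$. A set $A \subseteq \mathbb{N}$ is an IP set if there exists a sequence $(x_i)_{i=1}^\infty$ in $\mathbb{N}$ such that $A$ contains $\{\sum_{f \in F} x_f : F \subseteq \mathbb{N} \text{ finite and nonempty}\}$. *)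

theory Defs
  imports "HOL-Analysis.Analysis" "HOL-Number_Theory.Cong"
begin

text \<open>The natural numbers of the source are the positive integers; sets of them are
  sets of type \<^typ>\<open>nat set\<close> contained in \<open>Npos\<close>.\<close>

abbreviation Npos :: "nat set" where
  "Npos \<equiv> {0<..}"

definition progression :: "nat \<Rightarrow> int \<Rightarrow> nat set" where
  "progression q c = {m \<in> Npos. \<exists>n \<in> Npos. int m = int q * int n + c}"

definition shift_back :: "nat set \<Rightarrow> nat \<Rightarrow> nat set" where
  "shift_back H n = {m \<in> Npos. m + n \<in> H}"

definition thick :: "nat set \<Rightarrow> bool" where
  "thick H \<longleftrightarrow> H \<subseteq> Npos \<and>
     (\<forall>F. finite F \<and> F \<subseteq> Npos \<longrightarrow> (\<exists>n \<in> Npos. (\<lambda>f. f + n) ` F \<subseteq> H))"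

definition dyn_system :: "'a metric \<Rightarrow> ('a \<Rightarrow> 'a) \<Rightarrow> bool" where
  "dyn_system X T \<longleftrightarrow> mspace X \<noteq> {} \<and> compact_space (mtopology_of X) \<and>
     continuous_map (mtopology_of X) (mtopology_of X) T"

definition minimal_system :: "'a metric \<Rightarrow> ('a \<Rightarrow> 'a) \<Rightarrow> bool" where
  "minimal_system X T \<longleftrightarrow> dyn_system X T \<and>
     (\<forall>Y. closedin (mtopology_of X) Y \<and> Y \<noteq> {} \<and> T ` Y \<subseteq> Y \<longrightarrow> Y = mspace X)"

text \<open>A definition cannot quantify over types, so the type in which the points of the
  systems live is a parameter. A set is dynamically thick when this predicate holds for
  every type \<open>'a\<close>; a theorem concluding it for a type variable \<open>'a\<close> says exactly that.\<close>

definition dynamically_thick :: "'a itself \<Rightarrow> nat set \<Rightarrow> bool" where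
  "dynamically_thick (_ :: 'a itself) A \<longleftrightarrow> A \<subseteq> Npos \<and>
     (\<forall>(X :: 'a metric) T x U.
        minimal_system X T \<and> x \<in> mspace X \<and> openin (mtopology_of X) U \<and> U \<noteq> {} \<longrightarrow>
        (\<exists>n \<in> A. (T ^^ n) x \<in> U))"

definition IP_set :: "nat set \<Rightarrow> bool" where
  "IP_set A \<longleftrightarrow> A \<subseteq> Npos \<and>
     (\<exists>x :: nat \<Rightarrow> nat. (\<forall>i \<in> Npos. x i \<in> Npos) \<and>
        {\<Sum>f\<in>F. x f | F. F \<subseteq> Npos \<and> finite F \<and> F \<noteq> {}} \<subseteq> A)"

end

theory Submission
  imports Defs
begin

text \<open>
  Dynamical thickness. Fix a minimal system, a point \<open>x\<close> and a nonempty open set \<open>U\<close>, and let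
  \<open>R\<close> be the set of times at which \<open>x\<close> visits \<open>U\<close>. By compactness \<open>R\<close> has bounded gaps. If \<open>R\<close>
  meets, for some \<open>i\<close>, every residue class modulo \<open>p\<^sub>i\<close>, then \<open>R\<close> meets the class of \<open>c\<^sub>i\<close> inside the thick set
  \<open>H\<^sub>i\<close>: the visits that realise the \<open>p\<^sub>i\<close> classes recur, as one finite pattern, whenever \<open>x\<close>
  returns close to itself, and these returns also have bounded gaps, so that a whole copy of the
  pattern fits into \<open>H\<^sub>i\<close> (lemma \<open>visit_in_thick_and_progression\<close>). Otherwise \<open>R\<close> misses, for
  every \<open>i\<close>, some class \<open>e\<^sub>i\<close> modulo \<open>p\<^sub>i\<close>. The Chinese remainder theorem then yields
  arbitrarily long intervals whose \<open>j\<close>-th element lies in the \<open>j\<close>-th missed class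
  (lemma \<open>interval_through_residue_classes\<close>), and such an interval contradicts the bounded gaps
  of \<open>R\<close>.

  Failure of the IP property. Suppose that \<open>A\<close> contains all finite sums of \<open>x\<^sub>1, x\<^sub>2, \<dots>\<close>.
  Call a pair \<open>i \<noteq> j\<close> exceptional if \<open>H\<^sub>i\<close> meets \<open>H\<^sub>j - x\<^sub>1\<close>. The indices \<open>i\<close> that are the
  first entry of an exceptional pair, or for which \<open>p\<^sub>i\<close> divides \<open>x\<^sub>1\<close>, form a finite set \<open>B\<close>.
  Some sum \<open>s\<close> of terms other than \<open>x\<^sub>1\<close> is divisible by all \<open>p\<^sub>i\<close> with \<open>i \<in> B\<close>. Both \<open>s\<close> and \<open>s + x\<^sub>1\<close> are in \<open>A\<close>, say in the \<open>i\<close>-th and the \<open>j\<close>-th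
  piece. If \<open>i \<noteq> j\<close>, the pair is exceptional; if \<open>i = j\<close>, both numbers are congruent to \<open>c\<^sub>i\<close>, so
  \<open>p\<^sub>i\<close> divides \<open>x\<^sub>1\<close>. Either way \<open>i \<in> B\<close>, hence \<open>c\<^sub>i \<equiv> s \<equiv> 0\<close> modulo \<open>p\<^sub>i\<close>, a contradiction.
\<close>

section \<open>Visits in minimal systems\<close>

lemma continuous_map_funpow:
  assumes "continuous_map S S T"
  shows "continuous_map S S (T ^^ n)"
proof (induction n)
  case 0
  show ?case by (simp add: id_def)
next
  case (Suc n)
  show ?case using continuous_map_compose[OF Suc assms] by (simp add: comp_def)
qed

lemma funpow_in_mspace:
  assumes "minimal_system X T" and "x \<in> mspace X"
  shows "(T ^^ n) x \<in> mspace X"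
proof -
  have "continuous_map (mtopology_of X) (mtopology_of X) (T ^^ n)"
    using assms(1) by (auto simp: minimal_system_def dyn_system_def intro: continuous_map_funpow)
  then show ?thesis using assms(2) by (auto simp: continuous_map_def)
qed

lemma openin_funpow_preimage:
  assumes "minimal_system X T" and "openin (mtopology_of X) V"
  shows "openin (mtopology_of X) {y \<in> mspace X. (T ^^ n) y \<in> V}"
proof -
  have "continuous_map (mtopology_of X) (mtopology_of X) (T ^^ n)"
    using assms(1) by (auto simp: minimal_system_def dyn_system_def intro: continuous_map_funpow)
  from openin_continuous_map_preimage[OF this assms(2)] show ?thesis by simp
qed

text \<open>The points that never visit \<open>V\<close> form a closed invariant set; it differs from the whole
  space because it omits the points of \<open>V\<close>, so by minimality it is empty.\<close>

lemma minimal_system_visits: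
  assumes min: "minimal_system X T" and V: "openin (mtopology_of X) V" "V \<noteq> {}"
    and y: "y \<in> mspace X"
  shows "\<exists>n. (T ^^ n) y \<in> V"
proof (rule ccontr)
  assume never: "\<not> ?thesis"
  define Y where "Y = mspace X - (\<Union>n. {y \<in> mspace X. (T ^^ n) y \<in> V})"
  have "openin (mtopology_of X) (\<Union>n. {y \<in> mspace X. (T ^^ n) y \<in> V})"
    using openin_funpow_preimage[OF min V(1)] by blast
  from closedin_diff[OF closedin_topspace this] have "closedin (mtopology_of X) Y"
    by (simp add: Y_def)
  have Y_iff: "z \<in> Y \<longleftrightarrow> z \<in> mspace X \<and> (\<forall>n. (T ^^ n) z \<notin> V)" for z
    by (auto simp: Y_def)
  have "y \<in> Y" using never y by (simp add: Y_iff)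
  have "T w \<in> Y" if w: "w \<in> Y" for w
  proof -
    have "T w \<in> mspace X"
      using funpow_in_mspace[OF min, of w 1] w by (simp add: Y_iff)
    moreover have "(T ^^ n) (T w) \<notin> V" for n
    proof -
      have "(T ^^ n) (T w) = (T ^^ Suc n) w" by (simp add: funpow_swap1)
      moreover have "(T ^^ Suc n) w \<notin> V" using w unfolding Y_iff by (elim conjE allE)
      ultimately show ?thesis by simp
    qed
    ultimately show ?thesis by (simp add: Y_iff)
  qed
  then have "T ` Y \<subseteq> Y" by blast
  moreover have "Y \<noteq> {}" using \<open>y \<in> Y\<close> by blast
  ultimately have whole: "Y = mspace X"
    using min \<open>closedin (mtopology_of X) Y\<close> by (simp add: minimal_system_def)
  obtain v where v: "v \<in> V" using V(2) by blast
  then have "v \<in> Y" using openin_subset[OF V(1)] whole by auto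
  then have "(T ^^ 0) v \<notin> V" unfolding Y_iff by (elim conjE allE)
  then show False using v by simp
qed

text \<open>Every point visits \<open>V\<close>, so the preimages of \<open>V\<close> under the iterates cover the space; a
  finite subcover bounds the waiting time uniformly over the space.\<close>

lemma visit_times_bounded_gaps:
  assumes min: "minimal_system X T" and V: "openin (mtopology_of X) V" "V \<noteq> {}"
    and x: "x \<in> mspace X"
  shows "\<exists>L. \<forall>m. \<exists>j\<le>L. (T ^^ (m + j)) x \<in> V"
proof -
  let ?P = "\<lambda>n. {y \<in> mspace X. (T ^^ n) y \<in> V}"
  have "compactin (mtopology_of X) (mspace X)"
    using min by (simp add: minimal_system_def dyn_system_def compact_space_def)
  moreover have "\<And>W. W \<in> range ?P \<Longrightarrow> openin (mtopology_of X) W"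
    using openin_funpow_preimage[OF min V(1)] by blast
  moreover have "mspace X \<subseteq> \<Union> (range ?P)"
    using minimal_system_visits[OF min V] by blast
  ultimately obtain \<F> where \<F>: "finite \<F>" "\<F> \<subseteq> range ?P" "mspace X \<subseteq> \<Union>\<F>"
    unfolding compactin_def by (metis (no_types, lifting))
  obtain J where J: "finite J" "\<F> = ?P ` J"
    using finite_subset_image[OF \<F>(1,2)] by blast
  have "\<exists>j\<le>Max J. (T ^^ (m + j)) x \<in> V" for m
  proof -
    obtain j where j: "j \<in> J" "(T ^^ j) ((T ^^ m) x) \<in> V"
      using \<F>(3) J(2) funpow_in_mspace[OF min x, of m] by blast
    have "(T ^^ (m + j)) x \<in> V" using j(2) by (simp add: add.commute[of m] funpow_add)
    then show ?thesis using Max_ge[OF J(1) j(1)] by blast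
  qed
  then show ?thesis by blast
qed

section \<open>Thick sets and residue classes\<close>

lemma thick_contains_interval:
  assumes "thick H"
  shows "\<exists>h. \<forall>k\<in>{1..K}. h + k \<in> H"
proof -
  have "finite {1..K} \<and> {1..K} \<subseteq> Npos" by auto
  then obtain h where "(\<lambda>f. f + h) ` {1..K} \<subseteq> H" using assms unfolding thick_def by blast
  then show ?thesis by (metis add.commute image_subset_iff)
qed

lemma progression_iff:
  assumes "q > 0"
  shows "m \<in> progression q c \<longleftrightarrow> m > 0 \<and> int m > c \<and> [int m = c] (mod int q)"
proof
  assume "m \<in> progression q c"
  then obtain n where "m > 0" "n > 0" "int m = int q * int n + c"
    by (auto simp: progression_def)
  then show "m > 0 \<and> int m > c \<and> [int m = c] (mod int q)"
    using assms by (simp add: cong_iff_dvd_diff)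
next
  assume m: "m > 0 \<and> int m > c \<and> [int m = c] (mod int q)"
  then obtain k where k: "int m - c = int q * k" by (auto simp: cong_iff_dvd_diff)
  then have "k > 0" using m assms
    by (metis diff_gt_0_iff_gt of_nat_0_less_iff zero_less_mult_pos)
  then have "nat k \<in> Npos" "int m = int q * int (nat k) + c" using k by auto
  then show "m \<in> progression q c" using m unfolding progression_def by blast
qed

text \<open>Choose for each class \<open>e\<close> modulo \<open>q\<close> a visit at a time \<open>\<nu> e\<close>. All these visits are repeated by
  the points of an open neighbourhood \<open>V\<close> of \<open>x\<close>, to which \<open>x\<close> returns with bounded gaps. A
  long enough interval in \<open>H\<close> contains such a return time \<open>t\<close> together with all \<open>t + \<nu> e\<close>, and
  these numbers represent every class modulo \<open>q\<close>.\<close>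

lemma visit_in_thick_and_progression:
  assumes min: "minimal_system X T" and x: "x \<in> mspace X" and U: "openin (mtopology_of X) U"
    and H: "thick H" and q: "q > 0"
    and visits: "\<And>e. \<exists>n. [n = e] (mod q) \<and> (T ^^ n) x \<in> U"
  shows "\<exists>n \<in> progression q c \<inter> H. (T ^^ n) x \<in> U"
proof -
  obtain \<nu> where \<nu>: "\<And>e. [\<nu> e = e] (mod q)" "\<And>e. (T ^^ \<nu> e) x \<in> U"
    using visits by metis
  define V where "V = (\<Inter>e<q. {y \<in> mspace X. (T ^^ \<nu> e) y \<in> U})"
  have "openin (mtopology_of X) V"
    unfolding V_def using q openin_funpow_preimage[OF min U]
    by (intro openin_Inter) auto
  moreover have "x \<in> V" using x \<nu>(2) by (auto simp: V_def)
  ultimately obtain L where L: "\<And>m. \<exists>j\<le>L. (T ^^ (m + j)) x \<in> V"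
    using visit_times_bounded_gaps[OF min _ _ x] by (metis empty_iff)
  define N where "N = (\<Sum>e<q. \<nu> e)"
  \<comment> \<open>Starting \<open>nat \<bar>c\<bar> + 1\<close> beyond \<open>h\<close> makes the visit exceed \<open>c\<close>, as membership in the
    progression demands.\<close>
  obtain h where h: "\<And>k. k \<in> {1..nat \<bar>c\<bar> + 1 + L + N} \<Longrightarrow> h + k \<in> H"
    using thick_contains_interval[OF H] by blast
  obtain j where j: "j \<le> L" "(T ^^ (h + nat \<bar>c\<bar> + 1 + j)) x \<in> V" using L by blast
  define t where "t = h + nat \<bar>c\<bar> + 1 + j"
  define e where "e = nat ((c - int t) mod int q)"
  have e: "e < q" "int e = (c - int t) mod int q"
    using q by (auto simp: e_def nat_less_iff)
  define n where "n = t + \<nu> e"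
  have "(T ^^ n) x = (T ^^ \<nu> e) ((T ^^ t) x)"
    by (simp add: n_def add.commute[of t] funpow_add)
  then have visit: "(T ^^ n) x \<in> U"
    using j(2) e(1) by (auto simp: V_def t_def)
  have "\<nu> e \<le> N" unfolding N_def using e(1) by (intro member_le_sum) auto
  then have inH: "n \<in> H"
    using h[of "n - h"] j(1) by (simp add: n_def t_def add.assoc)
  have "[int (\<nu> e) = c - int t] (mod int q)"
    using \<nu>(1)[of e] e(2) by (metis cong_def cong_int_iff mod_mod_trivial)
  then have "[int n = c] (mod int q)"
    by (simp add: n_def cong_iff_dvd_diff algebra_simps)
  moreover have "int n > c" "n > 0" by (auto simp: n_def t_def)
  ultimately have "n \<in> progression q c" using progression_iff[OF q] by blast
  then show ?thesis using inH visit by blast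
qed

lemma interval_through_residue_classes:
  fixes q e :: "nat \<Rightarrow> nat"
  assumes "\<And>i. i \<le> L \<Longrightarrow> q i > 0"
    and "\<And>i j. i \<le> L \<Longrightarrow> j \<le> L \<Longrightarrow> i \<noteq> j \<Longrightarrow> coprime (q i) (q j)"
  shows "\<exists>m. \<forall>j\<le>L. [m + j = e j] (mod q j)"
proof -
  \<comment> \<open>The summand \<open>j * (q j - 1)\<close> is \<open>- j\<close> modulo \<open>q j\<close>, written without subtraction from \<open>e j\<close>.\<close>
  obtain m where m: "\<And>j. j \<le> L \<Longrightarrow> [m = e j + j * (q j - 1)] (mod q j)"
    using chinese_remainder_nat[of "{..L}" q "\<lambda>j. e j + j * (q j - 1)"] assms(2) by auto
  have "[m + j = e j] (mod q j)" if j: "j \<le> L" for j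
  proof -
    have "[m + j = e j + j * (q j - 1) + j] (mod q j)"
      using m[OF j] by (simp add: cong_add_rcancel_nat)
    also have "e j + j * (q j - 1) + j = e j + j * q j"
      using assms(1)[OF j] by (cases "q j") auto
    also have "[e j + j * q j = e j] (mod q j)" by (simp add: cong_def)
    finally show ?thesis .
  qed
  then show ?thesis by blast
qed

section \<open>Dynamical thickness of the union\<close>

lemma dynamically_thick_Union_progressions:
  fixes p :: "nat \<Rightarrow> nat" and c :: "nat \<Rightarrow> int" and H :: "nat \<Rightarrow> nat set"
  assumes prime: "\<And>i. i \<in> Npos \<Longrightarrow> prime (p i)" and inj: "inj_on p Npos"
    and thick: "\<And>i. i \<in> Npos \<Longrightarrow> thick (H i)"
  shows "dynamically_thick TYPE('a) (\<Union>i \<in> Npos. progression (p i) (c i) \<inter> H i)"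
    (is "dynamically_thick _ ?A")
  unfolding dynamically_thick_def
proof (intro conjI allI impI)
  show "?A \<subseteq> Npos" by (auto simp: progression_def)
next
  fix X :: "'a metric" and T x U
  assume "minimal_system X T \<and> x \<in> mspace X \<and> openin (mtopology_of X) U \<and> U \<noteq> {}"
  then have min: "minimal_system X T" and x: "x \<in> mspace X"
    and U: "openin (mtopology_of X) U" "U \<noteq> {}" by auto
  show "\<exists>n\<in>?A. (T ^^ n) x \<in> U"
  proof (rule ccontr)
    assume none: "\<not> ?thesis"
    have missed: "\<exists>e. \<forall>n. [n = e] (mod p i) \<longrightarrow> (T ^^ n) x \<notin> U" if i: "i \<in> Npos" for i
    proof (rule ccontr)
      assume "\<not> ?thesis"
      then have "\<And>e. \<exists>n. [n = e] (mod p i) \<and> (T ^^ n) x \<in> U" by blast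
      then have "\<exists>n \<in> progression (p i) (c i) \<inter> H i. (T ^^ n) x \<in> U"
        using visit_in_thick_and_progression[OF min x U(1) thick[OF i]] prime[OF i]
        by (simp add: prime_gt_0_nat)
      then show False using none i by blast
    qed
    then obtain e where
      e: "\<And>i n. i \<in> Npos \<Longrightarrow> [n = e i] (mod p i) \<Longrightarrow> (T ^^ n) x \<notin> U"
      by metis
    obtain L where L: "\<And>m. \<exists>j\<le>L. (T ^^ (m + j)) x \<in> U"
      using visit_times_bounded_gaps[OF min U x] by blast
    have "\<exists>m. \<forall>j\<le>L. [m + j = e (Suc j)] (mod p (Suc j))"
    proof (rule interval_through_residue_classes)
      fix i j :: nat
      show "p (Suc i) > 0" using prime[of "Suc i"] by (simp add: prime_gt_0_nat)
      assume "i \<noteq> j"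
      then have "p (Suc i) \<noteq> p (Suc j)" using inj by (auto dest: inj_onD)
      then show "coprime (p (Suc i)) (p (Suc j))"
        using prime by (simp add: primes_coprime)
    qed
    then show False using L e by (meson greaterThan_iff zero_less_Suc)
  qed
qed

section \<open>Failure of the IP property\<close>

text \<open>Two of the first \<open>P + 1\<close> partial sums agree modulo \<open>P\<close>.\<close>

lemma block_sum_divisible:
  fixes x :: "nat \<Rightarrow> nat"
  assumes "P > 0"
  shows "\<exists>a b. N \<le> a \<and> a < b \<and> P dvd (\<Sum>i=a..<b. x i)"
proof -
  let ?f = "\<lambda>k. (\<Sum>i=N..<N + k. x i) mod P"
  have "?f ` {..P} \<subseteq> {..<P}" using assms by auto
  then have "card (?f ` {..P}) \<le> P"
    using card_mono[of "{..<P}" "?f ` {..P}"] by simp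
  then have "\<not> inj_on ?f {..P}" by (intro pigeonhole) simp
  then obtain k l where kl: "k < l" "?f k = ?f l"
    unfolding inj_on_def by (metis linorder_neqE_nat)
  have "(\<Sum>i=N..<N + l. x i) = (\<Sum>i=N..<N + k. x i) + (\<Sum>i=N + k..<N + l. x i)"
    using kl(1) by (simp add: sum.atLeastLessThan_concat)
  then have "P dvd (\<Sum>i=N + k..<N + l. x i)"
    using kl(2) by (metis add_diff_cancel_left' le_add1 mod_eq_dvd_iff_nat)
  then show ?thesis using kl(1) by (intro exI[of _ "N + k"] exI[of _ "N + l"]) auto
qed

lemma finite_index_prime_dvd:
  fixes p :: "nat \<Rightarrow> nat"
  assumes "inj_on p I" and "n > 0"
  shows "finite {i \<in> I. p i dvd n}"
proof (rule finite_imageD)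
  have "p ` {i \<in> I. p i dvd n} \<subseteq> {d. d dvd n}" by blast
  then show "finite (p ` {i \<in> I. p i dvd n})"
    using finite_divisors_nat[OF assms(2)] by (rule finite_subset)
  show "inj_on p {i \<in> I. p i dvd n}"
    by (rule inj_on_subset[OF assms(1)]) (rule Collect_restrict)
qed

lemma not_IP_set_Union_progressions:
  fixes p :: "nat \<Rightarrow> nat" and c :: "nat \<Rightarrow> int" and H :: "nat \<Rightarrow> nat set"
  assumes prime: "\<And>i. i \<in> Npos \<Longrightarrow> prime (p i)" and inj: "inj_on p Npos"
    and c: "\<And>i. i \<in> Npos \<Longrightarrow> \<not> [c i = 0] (mod int (p i))"
    and few: "\<And>n. n \<in> Npos \<Longrightarrow> finite {(i, j). i \<in> Npos \<and> j \<in> Npos \<and> i \<noteq> j \<and>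
      H i \<inter> shift_back (H j) n \<noteq> {}}"
  shows "\<not> IP_set (\<Union>i \<in> Npos. progression (p i) (c i) \<inter> H i)" (is "\<not> IP_set ?A")
proof
  assume "IP_set ?A"
  then obtain x where pos: "\<forall>i\<in>Npos. x i \<in> Npos"
    and FS: "{\<Sum>f\<in>F. x f | F. F \<subseteq> Npos \<and> finite F \<and> F \<noteq> {}} \<subseteq> ?A"
    unfolding IP_set_def by (elim conjE exE)
  have sums: "(\<Sum>f\<in>F. x f) \<in> ?A" if "F \<subseteq> Npos" "finite F" "F \<noteq> {}" for F
    by (rule subsetD[OF FS], rule CollectI) (use that in blast)
  define E where "E = {(i, j). i \<in> Npos \<and> j \<in> Npos \<and> i \<noteq> j \<and>
    H i \<inter> shift_back (H j) (x 1) \<noteq> {}}"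
  define B where "B = fst ` E \<union> {i \<in> Npos. p i dvd x 1}"
  have x1: "x 1 \<in> Npos" using pos by simp
  have "finite B"
    using few[OF x1] finite_index_prime_dvd[OF inj, of "x 1"] x1 by (auto simp: B_def E_def)
  have B_pos: "B \<subseteq> Npos" by (auto simp: B_def E_def)
  then have "(\<Prod>i\<in>B. p i) > 0"
    using prime by (intro prod_pos) (auto simp: prime_gt_0_nat)
  then obtain a b where ab: "2 \<le> a" "a < b" and dvd: "(\<Prod>i\<in>B. p i) dvd (\<Sum>i=a..<b. x i)"
    using block_sum_divisible by blast
  define s where "s = (\<Sum>i=a..<b. x i)"
  have p_dvd: "p i dvd s" if "i \<in> B" for i
    using dvd_prodI[OF \<open>finite B\<close> that, of p] dvd unfolding s_def by (rule dvd_trans)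
  have "s \<in> ?A" unfolding s_def using ab by (intro sums) auto
  then obtain i where i: "i \<in> Npos" "s \<in> progression (p i) (c i)" "s \<in> H i" by blast
  have "s + x 1 = (\<Sum>f\<in>insert 1 {a..<b}. x f)" using ab by (simp add: s_def)
  also have "\<dots> \<in> ?A" using ab by (intro sums) auto
  finally obtain j where
    j: "j \<in> Npos" "s + x 1 \<in> progression (p j) (c j)" "s + x 1 \<in> H j" by blast
  have p_pos: "p k > 0" if "k \<in> Npos" for k using prime[OF that] by (simp add: prime_gt_0_nat)
  have s: "s > 0" "[int s = c i] (mod int (p i))"
    using i(2) progression_iff[OF p_pos[OF i(1)]] by auto
  have "i \<in> B"
  proof (cases "i = j")
    case True
    have "[int (s + x 1) = int s] (mod int (p i))"
      using j(2) progression_iff[OF p_pos[OF j(1)]] s(2) True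
      by (metis cong_sym cong_trans)
    then have "p i dvd x 1" by (simp add: cong_iff_dvd_diff)
    then show ?thesis using i(1) by (simp add: B_def)
  next
    case False
    have "s \<in> H i \<inter> shift_back (H j) (x 1)"
      using i(3) j(3) s(1) by (simp add: shift_back_def)
    then have "(i, j) \<in> E" using i(1) j(1) False by (auto simp: E_def)
    then show ?thesis by (force simp: B_def)
  qed
  then have "[int s = 0] (mod int (p i))"
    using p_dvd by (simp add: cong_0_iff)
  then have "[c i = 0] (mod int (p i))" using s(2) by (metis cong_sym cong_trans)
  then show False using c[OF i(1)] by blast
qed

section \<open>The proposition\<close>

theorem proposition4p2:
  fixes p :: "nat \<Rightarrow> nat" and c :: "nat \<Rightarrow> int" and H :: "nat \<Rightarrow> nat set" and A :: "nat set"
  assumes "\<forall>i \<in> Npos. prime (p i)"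
    and "inj_on p Npos"
    and "\<forall>i \<in> Npos. thick (H i)"
    and "A = (\<Union>i \<in> Npos. progression (p i) (c i) \<inter> H i)"
  shows "dynamically_thick TYPE('a) A \<and>
    ((\<forall>n \<in> Npos. \<not> [c n = 0] (mod int (p n)) \<and>
        finite {(i, j). i \<in> Npos \<and> j \<in> Npos \<and> i \<noteq> j \<and> H i \<inter> shift_back (H j) n \<noteq> {}})
      \<longrightarrow> \<not> IP_set A)"
proof (intro conjI impI)
  show "dynamically_thick TYPE('a) A"
    unfolding assms(4) using assms(1-3) by (intro dynamically_thick_Union_progressions) auto
next
  assume hyp: "\<forall>n \<in> Npos. \<not> [c n = 0] (mod int (p n)) \<and>
    finite {(i, j). i \<in> Npos \<and> j \<in> Npos \<and> i \<noteq> j \<and> H i \<inter> shift_back (H j) n \<noteq> {}}"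
  show "\<not> IP_set A"
    unfolding assms(4)
  proof (rule not_IP_set_Union_progressions)
    show "prime (p i)" if "i \<in> Npos" for i using assms(1) that by blast
    show "inj_on p Npos" by (rule assms(2))
    show "\<not> [c i = 0] (mod int (p i))" if "i \<in> Npos" for i using hyp that by blast
    show "finite {(i, j). i \<in> Npos \<and> j \<in> Npos \<and> i \<noteq> j \<and> H i \<inter> shift_back (H j) n \<noteq> {}}"
      if "n \<in> Npos" for n using hyp that by blast
  qed
qed

end
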